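(* The binary operation $\star$ on $\mathbf{L}$ (defined in the context) is a $t_r$-norm on $\mathbf{L}$; that is, $\star$ takes values in $\mathbf{L}$ and, as an operation $\mathbf{L}^2\to\mathbf{L}$, satisfies axioms (O1)–(O7) listed in the context.
   Context: Let $I=[0,1]$, let $\mathbf{M}$ be the set of all functions $f:I\to I$, and let $\vee,\wedge$ be max and min on $I$ (also applied pointwise). A function $f\in\mathbf{M}$ is normal if $\sup_{x\in I}f(x)=1$, and convex if $f(y)\ge f(x)\wedge f(z)$ whenever $0\le x\le y\le z\le 1$. $\mathbf{L}$ is the set of all normal and convex $f\in\mathbf{M}$. For $B\subseteq I$, $\mathbf{1}_B:I\to I$ is the characteristic function of $B$. $\mathbf{J}=\{\mathbf{1}_{\{x\}}\mid x\in I\}$ and $\mathbf{K}=\{\mathbf{1}_{[a,b]}\mid 0\le a\le b\le 1\}$. Order: for $f,g\in\mathbf{M}$ let $(f\sqcap g)(x)=\sup\{f(y)\wedge g(z)\mid y\wedge z=x\}$, and write $f\sqsubseteq g$ if $f\sqcap g=f$. For $f\in\mathbf{M}$: $f^L(x)=\sup\{f(y)\mid y\le x\}$ and $f^R(x)=\sup\{f(y)\mid y\ge x\}$. For $f,g\in\mathbf{L}$: $\eta_{f,g}=\inf\{x\in I\mid f^L(x)=1\}\wedge\inf\{x\in I\mid g^L(x)=1\}$, $\xi_{f,g}=\sup\{x\in I\mid f^R(x)=1\}\wedge\sup\{x\in I\mid g^R(x)=1\}$ (one has $\eta_{f,g}\le\xi_{f,g}$). The operation $\star:\mathbf{L}^2\to\mathbf{M}$: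 if $f=\mathbf{1}_{\{1\}}$ then $f\star g=g\star f=g$; if $g=\mathbf{1}_{\{1\}}$ then $f\star g=g\star f=f$; if $f\ne\mathbf{1}_{\{1\}}$ and $g\neq\mathbf{1}_{\{1\}}$ then $$(f\star g)(t)=\begin{cases} f^L(t)\vee g^L(t), & t\in[0,\eta_{f,g}),\\ 1,& t\in[\eta_{f,g},\xi_{f,g}),\\ f^R(\xi_{f,g})\wedge g^R(\xi_{f,g}), & t=\xi_{f,g},\\ 0,& t\in(\xi_{f,g},1].\end{cases}$$ A binary operation $T:\mathbf{L}^2\to\mathbf{L}$ is a $t_r$-norm if: (O1) $T(f,g)=T(g,f)$ for $f,g\in\mathbf{L}$; (O2) $T(T(f,g),h)=T(f,T(g,h))$ for $f,g,h\in\mathbf{L}$; (O3) $T(f,\mathbf{1}_{\{1\}})=f$ for $f\in\mathbf{L}$; (O4) for $f,g,h\in\mathbf{L}$ with $f\sqsubseteq g$, $T(f,h)\sqsubseteq T(g,h)$; (O5) $T(\mathbf{1}_{[0,1]},\mathbf{1}_{[a,b]})=\mathbf{1}_{[0,b]}$ for $0\le a\le b\le 1$; (O6) $T$ is closed on $\mathbf{J}$ (i.e. $T(\mathbf{J}^2)\subseteq\mathbf{J}$); (O7) $T$ is closed on $\mathbf{K}$ (i.e. $T(\mathbf{K}^2)\subseteq\mathbf{K}$). *)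

theory Defs
  imports Complex_Main "HOL-Library.FuncSet" "HOL-Library.Indicator_Function"
begin

abbreviation unit_I :: "real set" where
  "unit_I \<equiv> {0..1}"

text \<open>
  Functions from \<open>[0,1]\<close> to \<open>[0,1]\<close> are represented by functions on the reals that are
  extensional outside \<open>[0,1]\<close>, so that HOL equality is equality of maps on \<open>[0,1]\<close>.
\<close>

definition M_set :: "(real \<Rightarrow> real) set" where
  "M_set = unit_I \<rightarrow>\<^sub>E unit_I"

definition normal_fn :: "(real \<Rightarrow> real) \<Rightarrow> bool" where
  "normal_fn f \<longleftrightarrow> (SUP x\<in>unit_I. f x) = 1"

definition convex_fn :: "(real \<Rightarrow> real) \<Rightarrow> bool" where
  "convex_fn f \<longleftrightarrow>
    (\<forall>x y z. 0 \<le> x \<and> x \<le> y \<and> y \<le> z \<and> z \<le> 1 \<longrightarrow> f y \<ge> min (f x) (f z))"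

definition L_set :: "(real \<Rightarrow> real) set" where
  "L_set = {f \<in> M_set. normal_fn f \<and> convex_fn f}"

definition char_fn :: "real set \<Rightarrow> real \<Rightarrow> real" where
  "char_fn B = (\<lambda>x\<in>unit_I. indicator B x)"

definition J_set :: "(real \<Rightarrow> real) set" where
  "J_set = {char_fn {x} | x. x \<in> unit_I}"

definition K_set :: "(real \<Rightarrow> real) set" where
  "K_set = {char_fn {a..b} | a b. 0 \<le> a \<and> a \<le> b \<and> b \<le> 1}"

text \<open>
  All suprema and infima below are taken in the reals; for arguments in \<open>M_set\<close>
  (respectively \<open>L_set\<close>, for the two bounds \<open>eta\<close> and \<open>xi\<close>) they range over nonempty
  subsets of \<open>[0,1]\<close>, hence agree with those taken in \<open>[0,1]\<close>.
\<close>

definition meet_conv :: "(real \<Rightarrow> real) \<Rightarrow> (real \<Rightarrow> real) \<Rightarrow> real \<Rightarrow> real" where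
  "meet_conv f g =
    (\<lambda>x\<in>unit_I. Sup {min (f y) (g z) | y z. y \<in> unit_I \<and> z \<in> unit_I \<and> min y z = x})"

definition sqle :: "(real \<Rightarrow> real) \<Rightarrow> (real \<Rightarrow> real) \<Rightarrow> bool" where
  "sqle f g \<longleftrightarrow> meet_conv f g = f"

definition left_sup :: "(real \<Rightarrow> real) \<Rightarrow> real \<Rightarrow> real" where
  "left_sup f = (\<lambda>x\<in>unit_I. Sup {f y | y. y \<in> unit_I \<and> y \<le> x})"

definition right_sup :: "(real \<Rightarrow> real) \<Rightarrow> real \<Rightarrow> real" where
  "right_sup f = (\<lambda>x\<in>unit_I. Sup {f y | y. y \<in> unit_I \<and> y \<ge> x})"

definition eta :: "(real \<Rightarrow> real) \<Rightarrow> (real \<Rightarrow> real) \<Rightarrow> real" where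
  "eta f g = min (Inf {x \<in> unit_I. left_sup f x = 1}) (Inf {x \<in> unit_I. left_sup g x = 1})"

definition xi :: "(real \<Rightarrow> real) \<Rightarrow> (real \<Rightarrow> real) \<Rightarrow> real" where
  "xi f g = min (Sup {x \<in> unit_I. right_sup f x = 1}) (Sup {x \<in> unit_I. right_sup g x = 1})"

text \<open>
  For \<open>f\<close> and \<open>g\<close> in \<open>L_set\<close> one has \<open>eta f g \<le> xi f g\<close>, so the order of the case
  distinction in the last branch is immaterial.
\<close>

definition star :: "(real \<Rightarrow> real) \<Rightarrow> (real \<Rightarrow> real) \<Rightarrow> real \<Rightarrow> real" where
  "star f g =
    (if f = char_fn {1} then g
     else if g = char_fn {1} then f
     else (\<lambda>t\<in>unit_I.
       if t < eta f g then max (left_sup f t) (left_sup g t)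
       else if t < xi f g then 1
       else if t = xi f g then min (right_sup f (xi f g)) (right_sup g (xi f g))
       else 0))"

text \<open>
  A binary operation on \<open>L_set\<close> is a total HOL function of which only the values on
  \<open>L_set\<close> matter; the first conjunct says that it maps \<open>L_set\<close> squared into \<open>L_set\<close>.
\<close>

definition t_r_norm :: "((real \<Rightarrow> real) \<Rightarrow> (real \<Rightarrow> real) \<Rightarrow> real \<Rightarrow> real) \<Rightarrow> bool" where
  "t_r_norm T \<longleftrightarrow>
    (\<forall>f\<in>L_set. \<forall>g\<in>L_set. T f g \<in> L_set) \<and>
    (\<forall>f\<in>L_set. \<forall>g\<in>L_set. T f g = T g f) \<and>
    (\<forall>f\<in>L_set. \<forall>g\<in>L_set. \<forall>h\<in>L_set. T (T f g) h = T f (T g h)) \<and>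
    (\<forall>f\<in>L_set. T f (char_fn {1}) = f) \<and>
    (\<forall>f\<in>L_set. \<forall>g\<in>L_set. \<forall>h\<in>L_set. sqle f g \<longrightarrow> sqle (T f h) (T g h)) \<and>
    (\<forall>a b. 0 \<le> a \<and> a \<le> b \<and> b \<le> 1 \<longrightarrow> T (char_fn {0..1}) (char_fn {a..b}) = char_fn {0..b}) \<and>
    (\<forall>f\<in>J_set. \<forall>g\<in>J_set. T f g \<in> J_set) \<and>
    (\<forall>f\<in>K_set. \<forall>g\<in>K_set. T f g \<in> K_set)"

end

(* An element f of L is recovered from its two monotone envelopes as the minimum of f^L and f^R,
   and on L the relation f \<sqsubseteq> g says exactly that g^L \<le> f^L and f^R \<le> g^R pointwise.
   With lo f = inf {f^L = 1} and hi f = sup {f^R = 1}, the star product of two non-units has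
   lower envelope max (f^L t) (g^L t) for t < min (lo f) (lo g) and 1 beyond, upper envelope
   min (f^R t) (g^R t) for t \<le> min (hi f) (hi g) and 0 beyond, and lo and hi take the minimum.
   In these coordinates every axiom is a comparison of finitely many cases. *)

theory Submission
  imports Defs
begin

section \<open>Order bounds for the two envelopes\<close>

lemma M_set_bounds: "f \<in> M_set \<Longrightarrow> x \<in> unit_I \<Longrightarrow> 0 \<le> f x \<and> f x \<le> 1"
  by (auto simp: M_set_def PiE_def Pi_def)

lemma M_set_eqI:
  assumes "f \<in> M_set" "g \<in> M_set" "\<And>x. x \<in> unit_I \<Longrightarrow> f x = g x"
  shows "f = g"
  using assms unfolding M_set_def by (rule PiE_ext)

lemma le_left_sup:
  assumes "f \<in> M_set" "x \<in> unit_I" "y \<in> unit_I" "y \<le> x"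
  shows "f y \<le> left_sup f x"
proof -
  have "bdd_above {f y |y. y \<in> unit_I \<and> y \<le> x}"
    using M_set_bounds[OF assms(1)] by (intro bdd_aboveI[of _ 1]) blast
  then show ?thesis
    using assms by (auto simp: left_sup_def intro!: cSup_upper)
qed

lemma le_right_sup:
  assumes "f \<in> M_set" "x \<in> unit_I" "y \<in> unit_I" "x \<le> y"
  shows "f y \<le> right_sup f x"
proof -
  have "bdd_above {f y |y. y \<in> unit_I \<and> y \<ge> x}"
    using M_set_bounds[OF assms(1)] by (intro bdd_aboveI[of _ 1]) blast
  then show ?thesis
    using assms by (auto simp: right_sup_def intro!: cSup_upper)
qed

lemma left_sup_leI:
  assumes "x \<in> unit_I" "\<And>y. y \<in> unit_I \<Longrightarrow> y \<le> x \<Longrightarrow> f y \<le> c"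
  shows "left_sup f x \<le> c"
proof -
  have "{f y |y. y \<in> unit_I \<and> y \<le> x} \<noteq> {}"
    using assms(1) by blast
  then show ?thesis
    using assms by (auto simp: left_sup_def intro!: cSup_least)
qed

lemma right_sup_leI:
  assumes "x \<in> unit_I" "\<And>y. y \<in> unit_I \<Longrightarrow> x \<le> y \<Longrightarrow> f y \<le> c"
  shows "right_sup f x \<le> c"
proof -
  have "{f y |y. y \<in> unit_I \<and> y \<ge> x} \<noteq> {}"
    using assms(1) by blast
  then show ?thesis
    using assms by (auto simp: right_sup_def intro!: cSup_least)
qed

lemma left_sup_bounds:
  assumes "f \<in> M_set" "x \<in> unit_I"
  shows "0 \<le> left_sup f x \<and> left_sup f x \<le> 1"
proof
  show "0 \<le> left_sup f x"
    using le_left_sup[OF assms assms(2) order_refl] M_set_bounds[OF assms] by linarith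
  show "left_sup f x \<le> 1"
    using M_set_bounds[OF assms(1)] by (intro left_sup_leI[OF assms(2)]) blast
qed

lemma right_sup_bounds:
  assumes "f \<in> M_set" "x \<in> unit_I"
  shows "0 \<le> right_sup f x \<and> right_sup f x \<le> 1"
proof
  show "0 \<le> right_sup f x"
    using le_right_sup[OF assms assms(2) order_refl] M_set_bounds[OF assms] by linarith
  show "right_sup f x \<le> 1"
    using M_set_bounds[OF assms(1)] by (intro right_sup_leI[OF assms(2)]) blast
qed

lemma left_sup_mono:
  assumes "f \<in> M_set" "x \<in> unit_I" "y \<in> unit_I" "x \<le> y"
  shows "left_sup f x \<le> left_sup f y"
  using assms by (intro left_sup_leI) (auto intro: le_left_sup)

lemma right_sup_antimono:
  assumes "f \<in> M_set" "x \<in> unit_I" "y \<in> unit_I" "x \<le> y"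
  shows "right_sup f y \<le> right_sup f x"
  using assms by (intro right_sup_leI) (auto intro: le_right_sup)

lemma less_left_supE:
  assumes "c < left_sup f x" "x \<in> unit_I"
  obtains y where "y \<in> unit_I" "y \<le> x" "c < f y"
  using left_sup_leI[OF assms(2), of f c] assms(1) by (meson not_le)

lemma less_right_supE:
  assumes "c < right_sup f x" "x \<in> unit_I"
  obtains y where "y \<in> unit_I" "x \<le> y" "c < f y"
  using right_sup_leI[OF assms(2), of f c] assms(1) by (meson not_le)

section \<open>Consequences of normality and convexity\<close>

lemma L_set_M: "f \<in> L_set \<Longrightarrow> f \<in> M_set"
  by (simp add: L_set_def)

text \<open>Values never exceed 1, so a supremum of 1 amounts to values arbitrarily close to 1. The
  quantifier over \<open>c\<close> is there because the supremum may not be attained.\<close>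

lemma normal_fn_iff:
  assumes "f \<in> M_set"
  shows "normal_fn f \<longleftrightarrow> (\<forall>c<1. \<exists>x\<in>unit_I. c < f x)"
proof -
  have bdd: "bdd_above (f ` unit_I)"
    using M_set_bounds[OF assms] by (intro bdd_aboveI[of _ 1]) blast
  have "(SUP x\<in>unit_I. f x) \<le> 1"
    using M_set_bounds[OF assms] by (intro cSUP_least) auto
  then have "normal_fn f \<longleftrightarrow> (\<forall>c<1. c < (SUP x\<in>unit_I. f x))"
    unfolding normal_fn_def by (metis antisym_conv1 not_less_iff_gr_or_eq)
  also have "\<dots> \<longleftrightarrow> (\<forall>c<1. \<exists>x\<in>unit_I. c < f x)"
    using bdd by (simp add: less_cSUP_iff)
  finally show ?thesis .
qed

lemma L_set_near_1:
  assumes "f \<in> L_set" "c < 1"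
  obtains x where "x \<in> unit_I" "c < f x"
  using assms normal_fn_iff[of f] by (auto simp: L_set_def)

text \<open>Values at or after \<open>p\<close> are capped by \<open>right_sup f p\<close>, which is
  below 1. A point whose value exceeds both \<open>c\<close> and this cap therefore lies before
  \<open>p\<close>.\<close>

lemma L_set_near_1_left:
  assumes "f \<in> L_set" "p \<in> unit_I" "right_sup f p < 1" "c < 1"
  obtains x where "x \<in> unit_I" "x < p" "c < f x"
proof -
  obtain x where x: "x \<in> unit_I" "max c (right_sup f p) < f x"
    using L_set_near_1[of f "max c (right_sup f p)"] assms by auto
  then have "x < p"
    using le_right_sup[OF L_set_M[OF assms(1)] assms(2) x(1)] by force
  with x that show ?thesis by simp
qed

lemma left_sup_1:
  assumes "f \<in> L_set"
  shows "left_sup f 1 = 1"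
proof (rule ccontr)
  assume "left_sup f 1 \<noteq> 1"
  then have "left_sup f 1 < 1"
    using left_sup_bounds[OF L_set_M[OF assms], of 1] by auto
  then obtain x where x: "x \<in> unit_I" "left_sup f 1 < f x"
    using L_set_near_1 assms by blast
  then show False
    using le_left_sup[OF L_set_M[OF assms], of 1 x] by auto
qed

lemma right_sup_0:
  assumes "f \<in> L_set"
  shows "right_sup f 0 = 1"
proof (rule ccontr)
  assume "right_sup f 0 \<noteq> 1"
  then have "right_sup f 0 < 1"
    using right_sup_bounds[OF L_set_M[OF assms], of 0] by auto
  then obtain x where x: "x \<in> unit_I" "right_sup f 0 < f x"
    using L_set_near_1 assms by blast
  then show False
    using le_right_sup[OF L_set_M[OF assms], of 0 x] by auto
qed

text \<open>The supremum 1 is approached on at least one side of \<open>x\<close>; if the right side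
  stays below 1, the left side must reach it.\<close>

lemma left_sup_eq_1_if_right_sup_less:
  assumes "f \<in> L_set" "x \<in> unit_I" "right_sup f x < 1"
  shows "left_sup f x = 1"
proof (rule ccontr)
  assume "left_sup f x \<noteq> 1"
  then have "left_sup f x < 1"
    using left_sup_bounds[OF L_set_M[OF assms(1)] assms(2)] by auto
  then obtain y where "y \<in> unit_I" "y < x" "left_sup f x < f y"
    using L_set_near_1_left assms by blast
  then show False
    using le_left_sup[OF L_set_M[OF assms(1)] assms(2), of y] by auto
qed

text \<open>This is where convexity enters: if \<open>f x\<close> were below both envelopes, points
  on either side of \<open>x\<close> would carry larger values.\<close>

lemma L_set_eq_min:
  assumes "f \<in> L_set" "x \<in> unit_I"
  shows "f x = min (left_sup f x) (right_sup f x)"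
proof (rule antisym)
  show "f x \<le> min (left_sup f x) (right_sup f x)"
    using le_left_sup le_right_sup L_set_M assms by simp
  show "min (left_sup f x) (right_sup f x) \<le> f x"
  proof (rule ccontr)
    assume "\<not> ?thesis"
    then have "f x < left_sup f x" "f x < right_sup f x" by auto
    then obtain y z where "y \<in> unit_I" "y \<le> x" "f x < f y" "z \<in> unit_I" "x \<le> z" "f x < f z"
      using assms(2) by (meson less_left_supE less_right_supE)
    then have "min (f y) (f z) > f x" "min (f y) (f z) \<le> f x"
      using assms by (auto simp: L_set_def convex_fn_def)
    then show False by linarith
  qed
qed

lemma L_set_eqI:
  assumes "f \<in> L_set" "g \<in> L_set"
    and "\<And>x. x \<in> unit_I \<Longrightarrow> left_sup f x = left_sup g x"
    and "\<And>x. x \<in> unit_I \<Longrightarrow> right_sup f x = right_sup g x"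
  shows "f = g"
  using assms by (intro M_set_eqI) (auto simp: L_set_M L_set_eq_min)

section \<open>The order in terms of envelopes\<close>

text \<open>If \<open>min y z = x\<close>, one argument equals \<open>x\<close> and the other ranges
  over everything from \<open>x\<close> on. The supremum thus splits in two, each half fixing one
  factor at \<open>x\<close> and replacing the other by its right envelope.\<close>

lemma meet_conv_eq:
  assumes "f \<in> M_set" "g \<in> M_set" "x \<in> unit_I"
  shows "meet_conv f g x = max (min (f x) (right_sup g x)) (min (right_sup f x) (g x))"
proof -
  define S where "S = {min (f y) (g z) |y z. y \<in> unit_I \<and> z \<in> unit_I \<and> min y z = x}"
  have "bdd_above S"
    unfolding S_def using M_set_bounds[OF assms(1)]
    by (intro bdd_aboveI[of _ 1]) (clarsimp simp: min_le_iff_disj)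
  then have ub: "min (f y) (g z) \<le> Sup S" if "y \<in> unit_I" "z \<in> unit_I" "min y z = x" for y z
    using that by (intro cSup_upper) (auto simp: S_def)
  have "min (f x) (g x) \<in> S"
    using assms(3) unfolding S_def by fastforce
  then have "S \<noteq> {}" by blast
  then have "Sup S \<le> max (min (f x) (right_sup g x)) (min (right_sup f x) (g x))"
  proof (rule cSup_least)
    fix s assume "s \<in> S"
    then obtain y z where yz: "s = min (f y) (g z)" "y \<in> unit_I" "z \<in> unit_I" "min y z = x"
      by (auto simp: S_def)
    then consider "y = x" "x \<le> z" | "z = x" "x \<le> y" by (auto simp: min_def split: if_splits)
    then show "s \<le> max (min (f x) (right_sup g x)) (min (right_sup f x) (g x))"
      using le_right_sup[OF assms(1,3) yz(2)] le_right_sup[OF assms(2,3) yz(3)] yz(1)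
      by cases auto
  qed
  moreover have "min (f x) (right_sup g x) \<le> Sup S"
  \<comment> \<open>\<open>right_sup g x\<close> may not be attained, so a supposed gap above
    \<open>Sup S\<close> is used to pick a \<open>z\<close> whose value already exceeds
    \<open>Sup S\<close>.\<close>
  proof (rule ccontr)
    assume "\<not> ?thesis"
    then have *: "Sup S < f x" "Sup S < right_sup g x" by auto
    then obtain z where "z \<in> unit_I" "x \<le> z" "Sup S < g z"
      using less_right_supE assms(3) by blast
    then show False using ub[of x z] assms(3) * by (simp add: min_absorb1)
  qed
  moreover have "min (right_sup f x) (g x) \<le> Sup S"
  proof (rule ccontr)
    assume "\<not> ?thesis"
    then have *: "Sup S < g x" "Sup S < right_sup f x" by auto
    then obtain z where "z \<in> unit_I" "x \<le> z" "Sup S < f z"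
      using less_right_supE assms(3) by blast
    then show False using ub[of z x] assms(3) * by (simp add: min_absorb2)
  qed
  moreover have "meet_conv f g x = Sup S"
    using assms(3) by (simp add: meet_conv_def S_def)
  ultimately show ?thesis by (auto intro!: antisym)
qed

lemma sqle_iff:
  assumes "f \<in> L_set" "g \<in> L_set"
  shows "sqle f g \<longleftrightarrow> (\<forall>x\<in>unit_I. left_sup g x \<le> left_sup f x \<and> right_sup f x \<le> right_sup g x)"
proof
  note M = L_set_M[OF assms(1)] L_set_M[OF assms(2)]
  assume "sqle f g"
  then have eq: "f x = max (min (f x) (right_sup g x)) (min (right_sup f x) (g x))"
    if "x \<in> unit_I" for x
    using meet_conv_eq[OF M that] by (simp add: sqle_def)
  show "\<forall>x\<in>unit_I. left_sup g x \<le> left_sup f x \<and> right_sup f x \<le> right_sup g x"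
  proof (intro ballI conjI)
    fix x assume x: "x \<in> unit_I"
    show "right_sup f x \<le> right_sup g x"
    proof (rule right_sup_leI[OF x])
      fix y assume y: "y \<in> unit_I" "x \<le> y"
      have "f y \<le> right_sup g y"
        using eq[OF y(1)] le_right_sup[OF M(2) y(1) y(1)] by linarith
      then show "f y \<le> right_sup g x"
        using right_sup_antimono[OF M(2) x y] by linarith
    qed
    show "left_sup g x \<le> left_sup f x"
    proof (rule left_sup_leI[OF x])
      fix y assume y: "y \<in> unit_I" "y \<le> x"
      show "g y \<le> left_sup f x"
      \<comment> \<open>By \<open>eq\<close>, \<open>f y\<close> dominates
        \<open>min (right_sup f y) (g y)\<close>. If that minimum is \<open>g y\<close>, the bound
        follows; otherwise \<open>right_sup f y\<close> is below 1, which forces the left envelope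
        of \<open>f\<close> to be 1 already at \<open>y\<close>.\<close>
      proof (cases "g y \<le> right_sup f y")
        case True
        then show ?thesis
          using eq[OF y(1)] le_left_sup[OF M(1) x y] by linarith
      next
        case False
        then have "left_sup f y = 1"
          using M_set_bounds[OF M(2) y(1)] y(1) assms(1)
          by (intro left_sup_eq_1_if_right_sup_less) auto
        then show ?thesis
          using left_sup_mono[OF M(1) y(1) x y(2)] M_set_bounds[OF M(2) y(1)] by linarith
      qed
    qed
  qed
next
  note M = L_set_M[OF assms(1)] L_set_M[OF assms(2)]
  assume le: "\<forall>x\<in>unit_I. left_sup g x \<le> left_sup f x \<and> right_sup f x \<le> right_sup g x"
  have "meet_conv f g x = f x" for x
  proof (cases "x \<in> unit_I")
    case True
    \<comment> \<open>In the formula for \<open>meet_conv f g x\<close>, the first half will be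
      \<open>f x\<close> itself, and the second at most the minimum of the two envelopes of
      \<open>f\<close>, which is again \<open>f x\<close>.\<close>
    have "g x \<le> left_sup f x"
      using le_left_sup[OF M(2) True True] le True by force
    moreover have "f x \<le> right_sup g x"
      using le_right_sup[OF M(1) True True] le True by force
    ultimately show ?thesis
      using meet_conv_eq[OF M True] L_set_eq_min[OF assms(1) True] by linarith
  next
    \<comment> \<open>Both functions take the default value \<open>undefined\<close> off the
      interval.\<close>
    case False
    then show ?thesis
      using M(1) PiE_arb[of f unit_I _ x] False
      by (simp add: meet_conv_def M_set_def del: atLeastAtMost_iff)
  qed
  then show "sqle f g" by (auto simp: sqle_def)
qed

section \<open>Where the envelopes reach and leave the value 1\<close>

definition lo :: "(real \<Rightarrow> real) \<Rightarrow> real" where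
  "lo f = Inf {x \<in> unit_I. left_sup f x = 1}"

definition hi :: "(real \<Rightarrow> real) \<Rightarrow> real" where
  "hi f = Sup {x \<in> unit_I. right_sup f x = 1}"

lemma eta_eq: "eta f g = min (lo f) (lo g)"
  by (simp add: eta_def lo_def)

lemma xi_eq: "xi f g = min (hi f) (hi g)"
  by (simp add: xi_def hi_def)

lemma lo_mem:
  assumes "f \<in> L_set"
  shows "lo f \<in> unit_I"
proof -
  have "1 \<in> {x \<in> unit_I. left_sup f x = 1}"
    using left_sup_1[OF assms] by simp
  then have "lo f \<le> 1" "0 \<le> lo f"
    unfolding lo_def by (auto intro!: cInf_lower cInf_greatest bdd_belowI[of _ 0])
  then show ?thesis by simp
qed

lemma hi_mem:
  assumes "f \<in> L_set"
  shows "hi f \<in> unit_I"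
proof -
  have "0 \<in> {x \<in> unit_I. right_sup f x = 1}"
    using right_sup_0[OF assms] by simp
  then have "0 \<le> hi f" "hi f \<le> 1"
    unfolding hi_def by (auto intro!: cSup_upper cSup_least bdd_aboveI[of _ 1])
  then show ?thesis by simp
qed

lemma left_sup_below_lo:
  assumes "f \<in> L_set" "t \<in> unit_I" "t < lo f"
  shows "left_sup f t < 1"
proof -
  have "left_sup f t \<noteq> 1"
  proof
    assume "left_sup f t = 1"
    then have "lo f \<le> t"
      unfolding lo_def using assms(2) by (intro cInf_lower) (auto intro!: bdd_belowI[of _ 0])
    with assms(3) show False by simp
  qed
  then show ?thesis
    using left_sup_bounds[OF L_set_M[OF assms(1)] assms(2)] by simp
qed

text \<open>The end point \<open>t = lo f\<close> is excluded because the infimum may not be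
  attained.\<close>

lemma left_sup_above_lo:
  assumes "f \<in> L_set" "t \<in> unit_I" "lo f < t"
  shows "left_sup f t = 1"
proof -
  have "{x \<in> unit_I. left_sup f x = 1} \<noteq> {}"
    using left_sup_1[OF assms(1)] by force
  then obtain x where "x \<in> unit_I" "left_sup f x = 1" "x < t"
    using cInf_lessD[OF _ assms(3)[unfolded lo_def]] by auto
  then show ?thesis
    using left_sup_mono[OF L_set_M[OF assms(1)], of x t] assms(2)
      left_sup_bounds[OF L_set_M[OF assms(1)] assms(2)] by simp
qed

lemma right_sup_above_hi:
  assumes "f \<in> L_set" "t \<in> unit_I" "hi f < t"
  shows "right_sup f t < 1"
proof -
  have "right_sup f t \<noteq> 1"
  proof
    assume "right_sup f t = 1"
    then have "t \<le> hi f"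
      unfolding hi_def using assms(2) by (intro cSup_upper) (auto intro!: bdd_aboveI[of _ 1])
    with assms(3) show False by simp
  qed
  then show ?thesis
    using right_sup_bounds[OF L_set_M[OF assms(1)] assms(2)] by simp
qed

lemma right_sup_below_hi:
  assumes "f \<in> L_set" "t \<in> unit_I" "t < hi f"
  shows "right_sup f t = 1"
proof -
  have "{x \<in> unit_I. right_sup f x = 1} \<noteq> {}"
    using right_sup_0[OF assms(1)] by force
  then obtain x where "x \<in> unit_I" "right_sup f x = 1" "t < x"
    using less_cSupD[OF _ assms(3)[unfolded hi_def]] by auto
  then show ?thesis
    using right_sup_antimono[OF L_set_M[OF assms(1)], of t x] assms(2)
      right_sup_bounds[OF L_set_M[OF assms(1)] assms(2)] by simp
qed

text \<open>If \<open>lo f\<close> differed from \<open>p\<close>, density would give a point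
  strictly between them where the assumed behaviour contradicts that of \<open>lo f\<close>. The
  envelope at \<open>p\<close> itself is left open.\<close>

lemma lo_eqI:
  assumes "f \<in> L_set" "p \<in> unit_I"
    and "\<And>t. t \<in> unit_I \<Longrightarrow> t < p \<Longrightarrow> left_sup f t < 1"
    and "\<And>t. t \<in> unit_I \<Longrightarrow> p < t \<Longrightarrow> left_sup f t = 1"
  shows "lo f = p"
proof (rule ccontr)
  assume "lo f \<noteq> p"
  then consider "lo f < p" | "p < lo f" by linarith
  then show False
  proof cases
    case 1
    then obtain t where "lo f < t" "t < p" using dense by blast
    then show False
      using assms(2) assms(3)[of t] left_sup_above_lo[of f t] lo_mem[of f] assms(1) by auto
  next
    case 2
    then obtain t where "p < t" "t < lo f" using dense by blast
    then show False
      using assms(2) assms(4)[of t] left_sup_below_lo[of f t] lo_mem[of f] assms(1) by auto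
  qed
qed

lemma hi_eqI:
  assumes "f \<in> L_set" "p \<in> unit_I"
    and "\<And>t. t \<in> unit_I \<Longrightarrow> t < p \<Longrightarrow> right_sup f t = 1"
    and "\<And>t. t \<in> unit_I \<Longrightarrow> p < t \<Longrightarrow> right_sup f t < 1"
  shows "hi f = p"
proof (rule ccontr)
  assume "hi f \<noteq> p"
  then consider "hi f < p" | "p < hi f" by linarith
  then show False
  proof cases
    case 1
    then obtain t where "hi f < t" "t < p" using dense by blast
    then show False
      using assms(2) assms(3)[of t] right_sup_above_hi[of f t] hi_mem[of f] assms(1) by auto
  next
    case 2
    then obtain t where "p < t" "t < hi f" using dense by blast
    then show False
      using assms(2) assms(4)[of t] right_sup_below_hi[of f t] hi_mem[of f] assms(1) by auto
  qed
qed

text \<open>Strictly between \<open>hi f\<close> and \<open>lo f\<close> both envelopes would be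
  below 1, so values near 1 would be missing on either side.\<close>

lemma lo_le_hi:
  assumes "f \<in> L_set"
  shows "lo f \<le> hi f"
proof (rule ccontr)
  assume "\<not> lo f \<le> hi f"
  then obtain t where t: "hi f < t" "t < lo f" using dense by (meson not_le)
  then have "t \<in> unit_I"
    using lo_mem[OF assms] hi_mem[OF assms] by auto
  then show False
    using left_sup_below_lo[OF assms, of t] right_sup_above_hi[OF assms, of t]
      left_sup_eq_1_if_right_sup_less[OF assms, of t] t by simp
qed

section \<open>The star product of two non-units\<close>

locale non_unit_pair =
  fixes f g :: "real \<Rightarrow> real"
  assumes f: "f \<in> L_set" and g: "g \<in> L_set"
    and f_ne: "f \<noteq> char_fn {1}" and g_ne: "g \<noteq> char_fn {1}"
begin

text \<open>These are \<open>eta f g\<close> and \<open>xi f g\<close>, the ends of the plateau at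
  1; in this locale \<open>x\<close> is thus a fixed threshold, not a running variable.\<close>

abbreviation "e \<equiv> min (lo f) (lo g)"
abbreviation "x \<equiv> min (hi f) (hi g)"

lemmas fM = L_set_M[OF f]
lemmas gM = L_set_M[OF g]

lemma e_mem: "e \<in> unit_I" and x_mem: "x \<in> unit_I" and e_le_x: "e \<le> x"
  using lo_mem[OF f] lo_mem[OF g] hi_mem[OF f] hi_mem[OF g] lo_le_hi[OF f] lo_le_hi[OF g]
  by auto

lemma star_apply:
  assumes "t \<in> unit_I"
  shows "star f g t =
    (if t < e then max (left_sup f t) (left_sup g t)
     else if t < x then 1
     else if t = x then min (right_sup f x) (right_sup g x)
     else 0)"
  by (simp only: star_def eta_eq xi_eq f_ne g_ne restrict_apply assms if_True if_False)

lemma star_between: "t \<in> unit_I \<Longrightarrow> e \<le> t \<Longrightarrow> t < x \<Longrightarrow> star f g t = 1"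
  by (simp only: star_apply not_less[symmetric] if_True if_False)

lemma star_at_x: "star f g x = min (right_sup f x) (right_sup g x)"
  using e_le_x by (simp only: star_apply[OF x_mem] not_less[symmetric] less_irrefl refl if_True if_False)

lemma star_above:
  assumes "t \<in> unit_I" "x < t"
  shows "star f g t = 0"
proof -
  have "\<not> t < e" "\<not> t < x" "t \<noteq> x" using assms(2) e_le_x by linarith+
  then show ?thesis by (simp only: star_apply[OF assms(1)] if_False)
qed

lemma star_M: "star f g \<in> M_set"
proof -
  have "star f g t \<in> unit_I" if "t \<in> unit_I" for t
    using left_sup_bounds[OF fM that] left_sup_bounds[OF gM that]
      right_sup_bounds[OF fM x_mem] right_sup_bounds[OF gM x_mem]
    unfolding star_apply[OF that] by (auto simp: le_max_iff_disj min_le_iff_disj)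
  moreover have "star f g t = undefined" if "t \<notin> unit_I" for t
    using that f_ne g_ne by (simp add: star_def del: atLeastAtMost_iff)
  ultimately show ?thesis unfolding M_set_def by (intro PiE_I)
qed

lemma star_mono_below_e:
  assumes "s \<in> unit_I" "t \<in> unit_I" "s \<le> t" "t < e"
  shows "star f g s \<le> star f g t"
  using assms left_sup_mono[OF fM assms(1-3)] left_sup_mono[OF gM assms(1-3)]
  by (auto simp: star_apply)

text \<open>If \<open>e = x\<close> and the value at \<open>x\<close> is less than 1, then the supremum 1 of \<open>f\<close> or of \<open>g\<close>
  is approached strictly to the left of \<open>x\<close>.\<close>

lemma star_near_1:
  assumes "s \<in> unit_I" "s = 0 \<or> s < x" "c < 1"
  obtains y where "y \<in> unit_I" "s \<le> y" "y \<le> max s e" "c < star f g y"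
proof (cases "e < x")
  case True
  \<comment> \<open>Here the plateau from \<open>e\<close> up to \<open>x\<close> is nonempty, and
    \<open>max s e\<close> lies on it.\<close>
  then have "max s e < x" using assms(2) e_mem by auto
  moreover have "max s e \<in> unit_I" using assms(1) e_mem by (auto simp: max_def)
  ultimately have "c < star f g (max s e)"
    using assms(3) star_between by simp
  then show ?thesis
    using that[of "max s e"] \<open>max s e \<in> unit_I\<close> by simp
next
  case False
  then have ex: "e = x" using e_le_x by linarith
  have sx: "s \<le> x" using assms x_mem by auto
  show ?thesis
  proof (cases "min (right_sup f x) (right_sup g x) < 1")
    case True
    then obtain y where y: "y \<in> unit_I" "y < x" "c < max (f y) (g y)"
      using L_set_near_1_left[OF f x_mem _ assms(3)] L_set_near_1_left[OF g x_mem _ assms(3)]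
      by (metis less_max_iff_disj min_less_iff_disj)
    then have "c < star f g y"
      using le_left_sup[OF fM y(1) y(1)] le_left_sup[OF gM y(1) y(1)] ex
      by (auto simp: star_apply)
    moreover have my: "max s y \<in> unit_I" using y assms(1) by (auto simp: max_def)
    \<comment> \<open>The witness is moved right to pass \<open>s\<close>. For \<open>s = 0\<close>
      it does not move; otherwise \<open>s\<close> and \<open>y\<close> both lie strictly before
      \<open>x = e\<close>, where the product is monotone.\<close>
    moreover have "max s y < e \<or> max s y = y"
      using assms(2) y ex by auto
    ultimately have "c < star f g (max s y)"
      using star_mono_below_e[OF y(1) my] by force
    then show ?thesis
      using my y(2) ex sx that[of "max s y"] by (simp only:)
  next
    case False
    \<comment> \<open>Both right envelopes are still 1 at \<open>x\<close>, so \<open>x\<close>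
      itself is a witness.\<close>
    then have "c < star f g x"
      using assms(3) star_at_x by linarith
    then show ?thesis
      using x_mem sx ex that[of x] by linarith
  qed
qed

lemma star_L: "star f g \<in> L_set"
proof -
  have "convex_fn (star f g)"
    unfolding convex_fn_def
  proof (intro allI impI)
    fix r s t :: real assume a: "0 \<le> r \<and> r \<le> s \<and> s \<le> t \<and> t \<le> 1"
    then have I: "r \<in> unit_I" "s \<in> unit_I" "t \<in> unit_I" by auto
    \<comment> \<open>The position of the middle point decides: the product increases before
      \<open>e\<close>, is 1 on the plateau and 0 after \<open>x\<close>. As
      \<open>s \<le> t\<close>, a middle point at or after \<open>x\<close> leaves only
      \<open>s = t = x\<close> or a right point with value 0.\<close>
    consider "s < e" | "e \<le> s" "s < x" | "s = x" "t = x" | "x < t" using a by linarith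
    then show "min (star f g r) (star f g t) \<le> star f g s"
    proof cases
      case 1
      then show ?thesis using star_mono_below_e[OF I(1,2)] a by (simp add: min.coboundedI1)
    next
      case 2
      then have "star f g s = 1" using I star_between by blast
      then show ?thesis using M_set_bounds[OF star_M I(1)] by (simp add: min_le_iff_disj)
    next
      case 3
      then show ?thesis by simp
    next
      case 4
      then have "star f g t = 0"
        using I star_above by blast
      then show ?thesis using M_set_bounds[OF star_M I(2)] by (simp add: min_le_iff_disj)
    qed
  qed
  moreover have "normal_fn (star f g)"
    unfolding normal_fn_iff[OF star_M]
  proof (intro allI impI)
    fix c :: real assume "c < 1"
    then show "\<exists>t\<in>unit_I. c < star f g t"
      using star_near_1[of 0 c] by force
  qed
  ultimately show ?thesis using star_M by (simp add: L_set_def)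
qed

text \<open>Before \<open>e\<close> the product is monotone and hence its own left envelope; from
  \<open>e\<close> on, the envelope already sees values arbitrarily close to 1.\<close>

lemma left_sup_star:
  assumes t: "t \<in> unit_I"
  shows "left_sup (star f g) t =
    (if t < lo f \<and> t < lo g then max (left_sup f t) (left_sup g t) else 1)"
proof (cases "t < e")
  case True
  have "left_sup (star f g) t = star f g t"
  proof (rule antisym)
    show "left_sup (star f g) t \<le> star f g t"
      using t True by (intro left_sup_leI star_mono_below_e) auto
  qed (use le_left_sup[OF star_M t t] in simp)
  then show ?thesis using True t by (simp add: star_apply)
next
  case False
  have "left_sup (star f g) t = 1"
  proof (rule ccontr)
    assume "left_sup (star f g) t \<noteq> 1"
    then have "left_sup (star f g) t < 1" using left_sup_bounds[OF star_M t] by simp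
    \<comment> \<open>Starting from \<open>s = 0\<close>, the upper bound on the witness becomes
      \<open>e\<close>, which puts it at or before \<open>t\<close>.\<close>
    then obtain y where "y \<in> unit_I" "y \<le> max 0 e" "left_sup (star f g) t < star f g y"
      using star_near_1[of 0 "left_sup (star f g) t"] by auto
    moreover from this have "y \<le> t" using False e_mem by (auto simp only: max_absorb2 not_less atLeastAtMost_iff)
    ultimately show False
      using le_left_sup[OF star_M t, of y] by simp
  qed
  then show ?thesis using False by auto
qed

text \<open>Before \<open>x\<close>, values close to 1 occur at or after \<open>t\<close>, and both
  factors still have right envelope 1. At \<open>x\<close> only the value there counts, since the
  product vanishes further on.\<close>

lemma right_sup_star:
  assumes t: "t \<in> unit_I"
  shows "right_sup (star f g) t =
    (if t \<le> hi f \<and> t \<le> hi g then min (right_sup f t) (right_sup g t) else 0)"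
proof -
  consider "t < x" | "t = x" | "x < t" by linarith
  then show ?thesis
  proof cases
    case 1
    have "right_sup (star f g) t = 1"
    proof (rule ccontr)
      assume "right_sup (star f g) t \<noteq> 1"
      then have "right_sup (star f g) t < 1" using right_sup_bounds[OF star_M t] by simp
      then obtain y where "y \<in> unit_I" "t \<le> y" "right_sup (star f g) t < star f g y"
        using star_near_1[of t "right_sup (star f g) t"] 1 t by auto
      then show False
        using le_right_sup[OF star_M t, of y] by simp
    qed
    then show ?thesis
      using 1 right_sup_below_hi[OF f t] right_sup_below_hi[OF g t] by simp
  next
    case 2
    have "right_sup (star f g) t = star f g t"
    proof (rule antisym)
      show "right_sup (star f g) t \<le> star f g t"
      proof (rule right_sup_leI[OF t])
        fix y assume "y \<in> unit_I" "t \<le> y"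
        then show "star f g y \<le> star f g t"
          using star_above[of y] 2 M_set_bounds[OF star_M t] by (cases "y = t") auto
      qed
    qed (use le_right_sup[OF star_M t t] in simp)
    then show ?thesis using star_at_x 2 by simp
  next
    case 3
    have "right_sup (star f g) t = 0"
    proof (rule antisym)
      show "right_sup (star f g) t \<le> 0"
        using star_above 3 by (intro right_sup_leI[OF t]) auto
    qed (use right_sup_bounds[OF star_M t] in simp)
    then show ?thesis using 3 by auto
  qed
qed

lemma lo_star: "lo (star f g) = e"
proof (rule lo_eqI[OF star_L e_mem])
  fix t assume t: "t \<in> unit_I"
  show "left_sup (star f g) t < 1" if "t < e"
    using that left_sup_below_lo[OF f t] left_sup_below_lo[OF g t] by (simp add: left_sup_star[OF t])
  show "left_sup (star f g) t = 1" if "e < t"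
    using that by (auto simp: left_sup_star[OF t])
qed

lemma hi_star: "hi (star f g) = x"
proof (rule hi_eqI[OF star_L x_mem])
  fix t assume t: "t \<in> unit_I"
  show "right_sup (star f g) t = 1" if "t < x"
    using that right_sup_below_hi[OF f t] right_sup_below_hi[OF g t]
    by (simp add: right_sup_star[OF t])
  show "right_sup (star f g) t < 1" if "x < t"
    using that by (auto simp: right_sup_star[OF t])
qed

end

section \<open>Characteristic functions of intervals\<close>

lemma char_fn_M: "char_fn B \<in> M_set"
  by (auto simp: char_fn_def M_set_def indicator_def)

lemma char_fn_apply: "t \<in> unit_I \<Longrightarrow> char_fn B t = (if t \<in> B then 1 else 0)"
  by (simp add: char_fn_def)

context
  fixes a b :: real
  assumes ab: "0 \<le> a" "a \<le> b" "b \<le> 1"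
begin

lemma char_fn_interval_L: "char_fn {a..b} \<in> L_set"
proof -
  have "normal_fn (char_fn {a..b})"
    unfolding normal_fn_iff[OF char_fn_M] using ab
    by (intro allI impI bexI[of _ a]) (auto simp: char_fn_apply)
  moreover have "convex_fn (char_fn {a..b})"
    unfolding convex_fn_def by (auto simp: char_fn_apply)
  ultimately show ?thesis using char_fn_M by (simp add: L_set_def)
qed

lemma left_sup_char_fn:
  assumes t: "t \<in> unit_I"
  shows "left_sup (char_fn {a..b}) t = (if a \<le> t then 1 else 0)"
proof (rule antisym)
  show "left_sup (char_fn {a..b}) t \<le> (if a \<le> t then 1 else 0)"
    using t by (intro left_sup_leI) (auto simp: char_fn_apply)
  show "(if a \<le> t then 1 else 0) \<le> left_sup (char_fn {a..b}) t"
    using le_left_sup[OF char_fn_M t, of a "{a..b}"] left_sup_bounds[OF char_fn_M t, of "{a..b}"] ab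
    by (auto simp: char_fn_apply)
qed

lemma right_sup_char_fn:
  assumes t: "t \<in> unit_I"
  shows "right_sup (char_fn {a..b}) t = (if t \<le> b then 1 else 0)"
proof (rule antisym)
  show "right_sup (char_fn {a..b}) t \<le> (if t \<le> b then 1 else 0)"
    using t by (intro right_sup_leI) (auto simp: char_fn_apply)
  show "(if t \<le> b then 1 else 0) \<le> right_sup (char_fn {a..b}) t"
    using le_right_sup[OF char_fn_M t, of b "{a..b}"] right_sup_bounds[OF char_fn_M t, of "{a..b}"] ab
    by (auto simp: char_fn_apply)
qed

lemma lo_char_fn: "lo (char_fn {a..b}) = a"
  using ab by (intro lo_eqI[OF char_fn_interval_L]) (auto simp: left_sup_char_fn)

lemma hi_char_fn: "hi (char_fn {a..b}) = b"
  using ab by (intro hi_eqI[OF char_fn_interval_L]) (auto simp: right_sup_char_fn)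

text \<open>The left end alone decides, since \<open>a = 1\<close> squeezes \<open>b\<close> to
  1.\<close>

lemma char_fn_eq_unit_iff: "char_fn {a..b} = char_fn {1} \<longleftrightarrow> a = 1"
proof
  assume "char_fn {a..b} = char_fn {1}"
  then have "char_fn {a..b} a = char_fn {1} a" by simp
  then show "a = 1" using ab by (auto simp: char_fn_apply split: if_splits)
qed (use ab in simp)

end

section \<open>Recognising the unit\<close>

lemma unit_L: "char_fn {1} \<in> L_set"
  using char_fn_interval_L[of 1 1] by simp

lemma left_sup_unit: "t \<in> unit_I \<Longrightarrow> left_sup (char_fn {1}) t = (if t = 1 then 1 else 0)"
  using left_sup_char_fn[of 1 1 t] by auto

lemma right_sup_unit: "t \<in> unit_I \<Longrightarrow> right_sup (char_fn {1}) t = 1"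
  using right_sup_char_fn[of 1 1 t] by auto

text \<open>Such an \<open>f\<close> vanishes before 1, so normality can only come from the point 1.
  Then \<open>right_sup f 1\<close> is 1, and by antitonicity the right envelope is 1 everywhere.
  Comparisons of envelopes deliver the hypothesis in this inequality form.\<close>

lemma L_set_eq_unitI:
  assumes "f \<in> L_set" "\<And>t. t \<in> unit_I \<Longrightarrow> t < 1 \<Longrightarrow> left_sup f t \<le> 0"
  shows "f = char_fn {1}"
proof -
  note M = L_set_M[OF assms(1)]
  have left: "left_sup f t = left_sup (char_fn {1}) t" if "t \<in> unit_I" for t
    using assms(2)[OF that] left_sup_bounds[OF M that] that left_sup_1[OF assms(1)]
    by (auto simp: left_sup_unit)
  have "f t = 0" if "t \<in> unit_I" "t < 1" for t
    using le_left_sup[OF M that(1) that(1)] assms(2)[OF that] M_set_bounds[OF M that(1)] by simp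
  then have "right_sup f 1 = 1"
    using L_set_near_1_left[OF assms(1), of 1 0] right_sup_bounds[OF M, of 1]
    by (metis atLeastAtMost_iff less_eq_real_def order_less_irrefl zero_less_one)
  then have right: "right_sup f t = right_sup (char_fn {1}) t" if "t \<in> unit_I" for t
    using right_sup_antimono[OF M that, of 1] right_sup_bounds[OF M that] that
    by (simp add: right_sup_unit)
  show ?thesis
    by (rule L_set_eqI[OF assms(1) unit_L left right])
qed

section \<open>Closure, commutativity and associativity\<close>

lemma star_unit_left [simp]: "star (char_fn {1}) g = g"
  by (simp add: star_def)

lemma star_unit_right [simp]: "star f (char_fn {1}) = f"
  by (simp add: star_def)

lemma star_closed:
  assumes "f \<in> L_set" "g \<in> L_set"
  shows "star f g \<in> L_set"
proof (cases "f = char_fn {1} \<or> g = char_fn {1}")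
  case False
  then interpret non_unit_pair f g using assms by unfold_locales auto
  show ?thesis by (rule star_L)
qed (use assms in auto)

text \<open>The formula is symmetric in its data. Only the order of the two unit tests differs, and
  they agree when both arguments are the unit, so membership in \<open>L_set\<close> does not
  enter.\<close>

lemma star_commute: "star f g = star g f"
  unfolding star_def eta_eq[of f g] eta_eq[of g f] xi_eq[of f g] xi_eq[of g f]
    min.commute[of "lo g"] min.commute[of "hi g"] min.commute[of "right_sup g _"]
    max.commute[of "left_sup g _"]
  by (simp only: split: if_split) blast

text \<open>The left envelope of the product dominates that of \<open>f\<close>, so a unit product
  would make \<open>f\<close> the unit. This keeps nested products inside
  \<open>non_unit_pair\<close>.\<close>

lemma star_ne_unit:
  assumes "f \<in> L_set" "g \<in> L_set" "f \<noteq> char_fn {1}" "g \<noteq> char_fn {1}"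
  shows "star f g \<noteq> char_fn {1}"
proof
  interpret non_unit_pair f g using assms by unfold_locales
  assume eq: "star f g = char_fn {1}"
  have "left_sup f t \<le> 0" if "t \<in> unit_I" "t < 1" for t
  proof -
    have "left_sup (star f g) t = 0"
      using that by (simp add: eq left_sup_unit)
    then show ?thesis
      unfolding left_sup_star[OF that(1)] by (auto split: if_splits)
  qed
  with L_set_eq_unitI f f_ne show False by blast
qed

text \<open>Both bracketings have left envelope the maximum of all three before the least
  \<open>lo\<close> and 1 afterwards, and right envelope the minimum of all three up to the least
  \<open>hi\<close> and 0 afterwards.\<close>

lemma star_assoc:
  assumes "f \<in> L_set" "g \<in> L_set" "h \<in> L_set"
  shows "star (star f g) h = star f (star g h)"
proof (cases "f = char_fn {1} \<or> g = char_fn {1} \<or> h = char_fn {1}")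
  case False
  then interpret fg: non_unit_pair f g using assms by unfold_locales auto
  interpret gh: non_unit_pair g h using assms False by unfold_locales auto
  interpret l: non_unit_pair "star f g" h
    using assms False star_ne_unit fg.star_L by unfold_locales auto
  interpret r: non_unit_pair f "star g h"
    using assms False star_ne_unit gh.star_L by unfold_locales auto
  show ?thesis
  proof (rule L_set_eqI[OF l.star_L r.star_L])
    fix t assume t: "t \<in> unit_I"
    show "left_sup (star (star f g) h) t = left_sup (star f (star g h)) t"
      unfolding l.left_sup_star[OF t] r.left_sup_star[OF t] fg.left_sup_star[OF t]
        gh.left_sup_star[OF t] fg.lo_star gh.lo_star
      by (auto simp: max.assoc)
    show "right_sup (star (star f g) h) t = right_sup (star f (star g h)) t"
      unfolding l.right_sup_star[OF t] r.right_sup_star[OF t] fg.right_sup_star[OF t]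
        gh.right_sup_star[OF t] fg.hi_star gh.hi_star
      by (auto simp: min.assoc)
  qed
qed auto

section \<open>Monotonicity\<close>

lemma lo_mono:
  assumes "f \<in> L_set" "g \<in> L_set" "\<And>t. t \<in> unit_I \<Longrightarrow> left_sup g t \<le> left_sup f t"
  shows "lo f \<le> lo g"
proof (rule ccontr)
  assume "\<not> ?thesis"
  then obtain t where t: "lo g < t" "t < lo f" using dense by (meson not_le)
  then have "t \<in> unit_I" using lo_mem[OF assms(1)] lo_mem[OF assms(2)] by auto
  then show False
    using assms(3)[of t] left_sup_below_lo[OF assms(1), of t] left_sup_above_lo[OF assms(2), of t] t
    by simp
qed

lemma hi_mono:
  assumes "f \<in> L_set" "g \<in> L_set" "\<And>t. t \<in> unit_I \<Longrightarrow> right_sup f t \<le> right_sup g t"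
  shows "hi f \<le> hi g"
proof (rule ccontr)
  assume "\<not> ?thesis"
  then obtain t where t: "hi g < t" "t < hi f" using dense by (meson not_le)
  then have "t \<in> unit_I" using hi_mem[OF assms(1)] hi_mem[OF assms(2)] by auto
  then show False
    using assms(3)[of t] right_sup_below_hi[OF assms(1), of t] right_sup_above_hi[OF assms(2), of t] t
    by simp
qed

lemma star_mono:
  assumes L: "f \<in> L_set" "g \<in> L_set" "h \<in> L_set" and "sqle f g"
  shows "sqle (star f h) (star g h)"
proof -
  have le: "left_sup g t \<le> left_sup f t" "right_sup f t \<le> right_sup g t" if "t \<in> unit_I" for t
    using \<open>sqle f g\<close> sqle_iff[OF L(1,2)] that by auto
  consider (h) "h = char_fn {1}" | (f) "f = char_fn {1}"
    | (g) "g = char_fn {1}" "f \<noteq> char_fn {1}" "h \<noteq> char_fn {1}"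
    | (none) "f \<noteq> char_fn {1}" "g \<noteq> char_fn {1}" "h \<noteq> char_fn {1}" by blast
  then show ?thesis
  proof cases
    case h
    then show ?thesis using \<open>sqle f g\<close> by simp
  next
    case f
    \<comment> \<open>The unit is the greatest element: before 1 the left envelope of
      \<open>g\<close> lies below that of the unit, which is 0.\<close>
    then have "g = char_fn {1}"
      using le(1) by (intro L_set_eq_unitI[OF L(2)]) (force simp: left_sup_unit)
    then show ?thesis
      using f star_closed[OF unit_L L(3)] by (auto simp: sqle_iff)
  next
    case g
    interpret fh: non_unit_pair f h using L g by unfold_locales
    \<comment> \<open>Since \<open>star g h\<close> is \<open>h\<close>, it remains to see that a
      product lies below its factor.\<close>
    have "sqle (star f h) h"
      unfolding sqle_iff[OF fh.star_L L(3)]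
      using left_sup_bounds[OF fh.gM] right_sup_bounds[OF fh.gM]
      by (simp add: fh.left_sup_star fh.right_sup_star del: atLeastAtMost_iff)
    then show ?thesis by (simp add: g(1))
  next
    case none
    interpret fh: non_unit_pair f h using L none by unfold_locales
    interpret gh: non_unit_pair g h using L none by unfold_locales
    \<comment> \<open>For the smaller product, the branch with left envelope 1 and the branch with
      right envelope 0 both begin no later; elsewhere the envelopes compare directly.\<close>
    have lo: "lo f \<le> lo g" and hi: "hi f \<le> hi g"
      using lo_mono[OF L(1,2) le(1)] hi_mono[OF L(1,2) le(2)] by auto
    show ?thesis
      unfolding sqle_iff[OF fh.star_L gh.star_L]
    proof (intro ballI conjI)
      fix t assume t: "t \<in> unit_I"
      show "left_sup (star g h) t \<le> left_sup (star f h) t"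
        using le(1)[OF t] lo left_sup_bounds[OF gh.star_M t]
        by (auto simp: fh.left_sup_star[OF t] gh.left_sup_star[OF t] split: if_splits)
      show "right_sup (star f h) t \<le> right_sup (star g h) t"
        using le(2)[OF t] hi right_sup_bounds[OF gh.star_M t]
        by (auto simp: fh.right_sup_star[OF t] gh.right_sup_star[OF t] split: if_splits)
    qed
  qed
qed

section \<open>Products of intervals and the remaining axioms\<close>

text \<open>The envelopes of an interval are steps at its ends, and the product takes the minimum of
  each end. Axioms (O5) to (O7) are all read off from this.\<close>

lemma star_char_fn:
  assumes "0 \<le> a" "a \<le> b" "b \<le> 1" "0 \<le> c" "c \<le> d" "d \<le> 1"
  shows "star (char_fn {a..b}) (char_fn {c..d}) = char_fn {min a c..min b d}"
proof (cases "a = 1 \<or> c = 1")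
  case True
  \<comment> \<open>One interval is \<open>{1}\<close>, hence the unit, and the minima return the
    ends of the other.\<close>
  then show ?thesis using assms by auto
next
  case False
  note ab = char_fn_interval_L[OF assms(1-3)] and cd = char_fn_interval_L[OF assms(4-6)]
  interpret non_unit_pair "char_fn {a..b}" "char_fn {c..d}"
    using False ab cd char_fn_eq_unit_iff[OF assms(1-3)] char_fn_eq_unit_iff[OF assms(4-6)]
    by unfold_locales auto
  have m: "0 \<le> min a c" "min a c \<le> min b d" "min b d \<le> 1" using assms by auto
  show ?thesis
  proof (rule L_set_eqI[OF star_L char_fn_interval_L[OF m]])
    fix t assume t: "t \<in> unit_I"
    show "left_sup (star (char_fn {a..b}) (char_fn {c..d})) t = left_sup (char_fn {min a c..min b d}) t"
      unfolding left_sup_star[OF t] left_sup_char_fn[OF m t] lo_char_fn[OF assms(1-3)]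
        lo_char_fn[OF assms(4-6)] left_sup_char_fn[OF assms(1-3) t] left_sup_char_fn[OF assms(4-6) t]
      by auto
    show "right_sup (star (char_fn {a..b}) (char_fn {c..d})) t = right_sup (char_fn {min a c..min b d}) t"
      unfolding right_sup_star[OF t] right_sup_char_fn[OF m t] hi_char_fn[OF assms(1-3)]
        hi_char_fn[OF assms(4-6)] right_sup_char_fn[OF assms(1-3) t] right_sup_char_fn[OF assms(4-6) t]
      by auto
  qed
qed

theorem theorem4p8: "t_r_norm star"
proof -
  have "star (char_fn {0..1}) (char_fn {a..b}) = char_fn {0..b}"
    if "0 \<le> a \<and> a \<le> b \<and> b \<le> 1" for a b
    using that star_char_fn[of 0 1 a b] by (simp add: min_absorb1 min_absorb2)
  moreover have "star f g \<in> J_set" if J: "f \<in> J_set" "g \<in> J_set" for f g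
  proof -
    obtain p q where pq: "f = char_fn {p}" "g = char_fn {q}" "p \<in> unit_I" "q \<in> unit_I"
      using J by (auto simp: J_set_def)
    \<comment> \<open>Singletons are treated as degenerate intervals.\<close>
    then have "star f g = char_fn {min p q}"
      using star_char_fn[of p p q q] by simp
    moreover have "min p q \<in> unit_I" using pq by (auto simp: min_def)
    ultimately show ?thesis by (auto simp: J_set_def simp del: atLeastAtMost_iff)
  qed
  moreover have "star f g \<in> K_set" if K: "f \<in> K_set" "g \<in> K_set" for f g
  proof -
    obtain a b c d where abcd: "f = char_fn {a..b}" "g = char_fn {c..d}"
      "0 \<le> a" "a \<le> b" "b \<le> 1" "0 \<le> c" "c \<le> d" "d \<le> 1"
      using K by (auto simp: K_set_def)
    then have "star f g = char_fn {min a c..min b d}"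
      by (simp only: star_char_fn)
    moreover have "0 \<le> min a c \<and> min a c \<le> min b d \<and> min b d \<le> 1" using abcd by auto
    ultimately show ?thesis unfolding K_set_def by blast
  qed
  ultimately show ?thesis
    using star_closed star_commute star_assoc star_mono star_unit_right
    unfolding t_r_norm_def by blast
qed

end
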